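(* Let $f:\mathbb{T}^2\to\mathbb{T}^2$ be a strongly volume expanding endomorphism whose linear part has integer eigenvalues $\lambda_1,\lambda_2$ with $|\lambda_1|\ge|\lambda_2|>1$. Then, given any non-empty open set $U\subset\mathbb{T}^2$, there exists $N\ge0$ such that $f^n(U)$ is doubly essential for every $n\ge N$.
   Context: $\mathbb{T}^2=\mathbb{R}^2/\mathbb{Z}^2$. An endomorphism is a non-invertible ($C^1$) local diffeomorphism $f:\mathbb{T}^2\to\mathbb{T}^2$. Its linear part is the $2\times2$ integer matrix $A$ giving the action of $f$ on $\pi_1(\mathbb{T}^2)\cong\mathbb{Z}^2$. $f$ is strongly volume expanding if there are $C>0$ and $\lambda>|\lambda_1|$ such that $|\det(Df^n_p)|\ge C\lambda^n$ for every $n\ge1$ and every $p\in\mathbb{T}^2$. An open set $V\subset\mathbb{T}^2$ is doubly essential if it contains loops $\gamma$ and $\sigma$ whose classes $[\gamma],[\sigma]\in\pi_1(\mathbb{T}^2)\cong\mathbb{Z}^2$ are linearly independent. *)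

theory Defs
  imports "HOL-Analysis.Analysis"
begin

section \<open>The torus as a topological space\<close>

definition int_translate :: "real ^ 2 \<Rightarrow> real ^ 2 \<Rightarrow> bool" where
  "int_translate x y \<longleftrightarrow> (\<forall>i. x $ i - y $ i \<in> \<int>)"

lemma equivp_int_translate: "equivp int_translate"
proof (rule equivpI)
  show "reflp int_translate"
    by (simp add: reflp_def int_translate_def)
  show "symp int_translate"
    unfolding symp_def int_translate_def by (metis Ints_minus minus_diff_eq)
  show "transp int_translate"
  proof (rule transpI)
    fix x y z :: "real ^ 2"
    assume "int_translate x y" "int_translate y z"
    then have "(x $ i - y $ i) + (y $ i - z $ i) \<in> \<int>" for i
      unfolding int_translate_def by (blast intro: Ints_add)
    then show "int_translate x z"
      by (simp add: int_translate_def)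
  qed
qed

quotient_type torus = "real ^ 2" / int_translate
  by (rule equivp_int_translate)

abbreviation proj :: "real ^ 2 \<Rightarrow> torus" where
  "proj \<equiv> abs_torus"

text \<open>The quotient topology.\<close>

instantiation torus :: topological_space
begin

definition open_torus :: "torus set \<Rightarrow> bool" where
  "open_torus U \<longleftrightarrow> open (proj -` U)"

instance
  by standard (auto simp: open_torus_def vimage_Union)

end

section \<open>Differentiability of maps of the torus\<close>

text \<open>
  The local inverses of \<^const>\<open>abs_torus\<close> are the charts of the torus, and they identify every
  tangent space with the plane.  In the following definition \<open>F\<close> is the expression of \<open>f\<close> in such
  charts near a representative \<open>x\<close> of \<open>p\<close>.  It is unique near \<open>x\<close> up to an integer translation,
  because differentiability at \<open>x\<close> includes continuity at \<open>x\<close>.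
\<close>

definition has_torus_derivative :: "(torus \<Rightarrow> torus) \<Rightarrow> real ^ 2 ^ 2 \<Rightarrow> torus \<Rightarrow> bool" where
  "has_torus_derivative f D p \<longleftrightarrow>
     (\<exists>x F. proj x = p \<and> (\<forall>\<^sub>F y in nhds x. proj (F y) = f (proj y)) \<and>
            (F has_derivative (\<lambda>h. D *v h)) (at x))"

definition torus_deriv :: "(torus \<Rightarrow> torus) \<Rightarrow> torus \<Rightarrow> real ^ 2 ^ 2" where
  "torus_deriv f p = (THE D. has_torus_derivative f D p)"

definition torus_C1_on :: "torus set \<Rightarrow> (torus \<Rightarrow> torus) \<Rightarrow> bool" where
  "torus_C1_on U f \<longleftrightarrow>
     (\<exists>Df. (\<forall>p\<in>U. has_torus_derivative f (Df p) p) \<and> continuous_on U Df)"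

definition C1_local_diffeo :: "(torus \<Rightarrow> torus) \<Rightarrow> bool" where
  "C1_local_diffeo f \<longleftrightarrow>
     (\<forall>p. \<exists>U V g. open U \<and> p \<in> U \<and> open V \<and> homeomorphism U V f g \<and>
                  torus_C1_on U f \<and> torus_C1_on V g)"

definition torus_endomorphism :: "(torus \<Rightarrow> torus) \<Rightarrow> bool" where
  "torus_endomorphism f \<longleftrightarrow> C1_local_diffeo f \<and> \<not> bij f"

definition strongly_volume_expanding :: "real \<Rightarrow> (torus \<Rightarrow> torus) \<Rightarrow> bool" where
  "strongly_volume_expanding l1 f \<longleftrightarrow>
     (\<exists>C>0. \<exists>\<mu>>\<bar>l1\<bar>. \<forall>n\<ge>1. \<forall>p. \<bar>det (torus_deriv (f ^^ n) p)\<bar> \<ge> C * \<mu> ^ n)"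

section \<open>Homotopy classes of loops\<close>

text \<open>
  \<open>has_loop_class \<gamma> v\<close> says that the class of the loop \<open>\<gamma>\<close> in the fundamental group based at the
  initial point of \<open>\<gamma>\<close> corresponds to \<open>v\<close> under the usual isomorphism with the group of integer
  vectors, which sends \<open>v\<close> to the class of the projection of a segment from \<open>x\<close> to \<open>x + v\<close>.
\<close>

definition has_loop_class :: "(real \<Rightarrow> torus) \<Rightarrow> int ^ 2 \<Rightarrow> bool" where
  "has_loop_class \<gamma> v \<longleftrightarrow>
     (\<exists>x. proj x = pathstart \<gamma> \<and>
          homotopic_paths UNIV \<gamma> (proj \<circ> linepath x (x + (\<chi> i. real_of_int (v $ i)))))"

definition is_linear_part :: "(torus \<Rightarrow> torus) \<Rightarrow> int ^ 2 ^ 2 \<Rightarrow> bool" where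
  "is_linear_part f A \<longleftrightarrow>
     (\<forall>\<gamma> v. has_loop_class \<gamma> v \<longrightarrow> has_loop_class (f \<circ> \<gamma>) (A *v v))"

definition doubly_essential :: "torus set \<Rightarrow> bool" where
  "doubly_essential V \<longleftrightarrow> open V \<and>
     (\<exists>\<gamma> \<sigma> v w. path \<gamma> \<and> pathfinish \<gamma> = pathstart \<gamma> \<and> path_image \<gamma> \<subseteq> V \<and> has_loop_class \<gamma> v \<and>
                path \<sigma> \<and> pathfinish \<sigma> = pathstart \<sigma> \<and> path_image \<sigma> \<subseteq> V \<and> has_loop_class \<sigma> w \<and>
                (\<forall>a b :: int. a *s v + b *s w = 0 \<longrightarrow> a = 0 \<and> b = 0))"

section \<open>Eigenvalues of an integer matrix\<close>

text \<open>
  All complex eigenvalues.  For a 2 by 2 matrix this set determines the multiplicities, so the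
  matrix has eigenvalues \<open>a, b\<close>, counted with multiplicity, iff this set equals \<open>{a, b}\<close>.
\<close>

definition eigenvalues :: "int ^ 2 ^ 2 \<Rightarrow> complex set" where
  "eigenvalues A = {c. \<exists>v. v \<noteq> 0 \<and> map_matrix complex_of_int A *v v = c *s v}"

end

theory Submission
  imports Defs
begin

text \<open>
  The proof compares two growth rates in the universal cover.

  Let \<open>F\<close> be a lift of \<open>f\<close> to the plane.  It satisfies \<open>F (x + v) = F x + A v\<close> for integer vectors
  \<open>v\<close>, so \<open>F\<close> stays at bounded distance from the linear map \<open>A\<close>, which is invertible.  Hence \<open>F\<close> is a
  proper local homeomorphism of the plane, therefore a covering map, and therefore injective
  (\<open>locally_inj_near_linear_imp_inj\<close>).

  Fix a ball \<open>B\<close> that projects into \<open>U\<close> and put \<open>W = F\<^sup>n(B)\<close>.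
    \<^item> Since \<open>F\<^sup>n\<close> is injective, the area of \<open>W\<close> is the integral of the Jacobian over \<open>B\<close>, so it is at
      least a positive constant times \<open>\<mu>\<^sup>n\<close> for some \<open>\<mu> > \<bar>\<lambda>\<^sub>1\<bar>\<close> (\<open>measure_injective_image_ge\<close>).
    \<^item> Two orbits of \<open>F\<close> separate no faster than orbits of \<open>A\<close> with bounded perturbations.
      By the theorem of Cayley and Hamilton \<open>(A - \<lambda>\<^sub>1)(A - \<lambda>\<^sub>2) = 0\<close>, and the diameter of \<open>W\<close> is at most a
      constant times \<open>n \<bar>\<lambda>\<^sub>1\<bar>\<^sup>n\<close> (\<open>perturbed_orbit_growth\<close>); the factor \<open>n\<close> accounts for a
      possible Jordan block.

  If \<open>W\<close> meets its translate by an integer vector \<open>v\<close>, then a path in \<open>W\<close> from \<open>y\<close> to \<open>y + v\<close> projects to a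
  loop in \<open>f\<^sup>n(U)\<close> of class \<open>v\<close>.  So if \<open>f\<^sup>n(U)\<close> is not doubly essential, there is a
  coordinate direction \<open>e\<close> such that \<open>W\<close> is disjoint from all its translates by positive multiples
  of \<open>e\<close> (\<open>not_doubly_essential_imp_disjoint_translates\<close>).  Packing these
  disjoint translates into a box bounds the area of \<open>W\<close> by a multiple of its diameter
  (\<open>measure_le_of_disjoint_translates\<close>).  For large \<open>n\<close> this contradicts the two growth rates.
\<close>

section \<open>The torus and its characters\<close>

definition of_ivec :: "int ^ 2 \<Rightarrow> real ^ 2" where
  "of_ivec v = (\<chi> i. real_of_int (v $ i))"

lemma of_ivec_nth [simp]: "of_ivec v $ i = real_of_int (v $ i)"
  by (simp add: of_ivec_def)

lemma of_ivec_0 [simp]: "of_ivec 0 = 0"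
  by (simp add: vec_eq_iff)

text \<open>
  Discreteness of the integer lattice.  It makes a small ball of the plane embed in the torus, and makes
  two local lifts of the same map differ by a constant translation.
\<close>

lemma of_ivec_close_imp_eq:
  assumes "dist (of_ivec v) (of_ivec w) < 1" shows "v = w"
proof -
  have "\<bar>real_of_int (v $ i - w $ i)\<bar> < 1" for i
    using component_le_norm_cart[of "of_ivec v - of_ivec w" i] assms
    by (simp add: dist_norm)
  then have "\<bar>v $ i - w $ i\<bar> < 1" for i
    by (metis of_int_abs of_int_less_1_iff)
  then show ?thesis by (simp add: vec_eq_iff)
qed

lemma proj_eq_iff: "proj x = proj y \<longleftrightarrow> (\<exists>v. x = y + of_ivec v)"
proof -
  have "int_translate x y \<longleftrightarrow> (\<forall>i. \<exists>k. x $ i = y $ i + real_of_int k)"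
    unfolding int_translate_def Ints_def by (auto simp: algebra_simps image_iff) 
  also have "\<dots> \<longleftrightarrow> (\<exists>v. x = y + of_ivec v)"
    unfolding choice_iff vec_eq_iff
    by (auto, rule_tac x="\<chi> i. f i" in exI, auto)
  finally show ?thesis
    by (simp add: torus.abs_eq_iff)
qed

lemma proj_add_of_ivec [simp]: "proj (x + of_ivec v) = proj x"
  using proj_eq_iff by blast

lemma torus_cases: obtains x where "p = proj x"
  by (metis Quotient3_abs_rep Quotient3_torus)

lemma continuous_on_proj [continuous_intros]: "continuous_on S proj"
  by (rule continuous_on_subset[of UNIV])
     (auto simp: continuous_on_open_vimage open_torus_def)

lemma vimage_proj_image: "proj -` (proj ` S) = (\<Union>v. (+) (of_ivec v) ` S)"
proof -
  have "x \<in> proj -` (proj ` S) \<longleftrightarrow> (\<exists>y\<in>S. \<exists>v. x = of_ivec v + y)" for x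
    by (simp add: image_iff proj_eq_iff add.commute)
  then show ?thesis by blast
qed

lemma open_proj_image:
  assumes "open S" shows "open (proj ` S)"
  unfolding open_torus_def vimage_proj_image
  using open_translation[OF assms] by blast

text \<open>
  The two circle-valued characters are continuous and separate the points of the torus.  They
  reduce lifting and homotopy questions on this quotient space to logarithms in the punctured
  complex plane.
\<close>

lift_definition torus_char :: "2 \<Rightarrow> torus \<Rightarrow> complex"
  is "\<lambda>i x. exp (2 * pi * \<i> * of_real (x $ i))"
proof -
  fix i :: 2 and x y :: "real ^ 2" assume "int_translate x y"
  then obtain k where "x $ i - y $ i = of_int k"
    unfolding int_translate_def Ints_def by blast
  then have k: "x $ i = y $ i + of_int k" by simp
  have "2 * pi * \<i> * of_real (x $ i) = 2 * pi * \<i> * of_real (y $ i) + of_int (2 * k) * pi * \<i>"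
    unfolding k by (simp add: algebra_simps)
  then show "exp (2 * pi * \<i> * of_real (x $ i)) = exp (2 * pi * \<i> * of_real (y $ i))"
    by (metis exp_eq)
qed

lemma torus_char_proj: "torus_char i (proj x) = exp (2 * pi * \<i> * of_real (x $ i))"
  by (rule torus_char.abs_eq)

lemma torus_char_nonzero [simp]: "torus_char i p \<noteq> 0"
  by (cases p rule: torus_cases) (simp add: torus_char_proj)

lemma continuous_on_torus_char: "continuous_on S (torus_char i)"
proof (rule continuous_on_subset[of UNIV])
  have "open (torus_char i -` B)" if "open B" for B
  proof -
    have "proj -` (torus_char i -` B) = (\<lambda>x. exp (2 * pi * \<i> * of_real (x $ i))) -` B"
      by (auto simp: torus_char_proj)
    moreover have "open \<dots>"
      by (intro open_vimage that continuous_intros)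
    ultimately show ?thesis by (simp add: open_torus_def)
  qed
  then show "continuous_on UNIV (torus_char i)"
    by (simp add: continuous_on_open_vimage)
qed auto

lemma torus_eqI:
  assumes "\<And>i. torus_char i p = torus_char i q" shows "p = q"
proof -
  obtain x y where xy: "p = proj x" "q = proj y" by (metis torus_cases)
  have "x $ i - y $ i \<in> \<int>" for i
  proof -
    obtain k :: int where "2 * pi * \<i> * of_real (x $ i) = 2 * pi * \<i> * of_real (y $ i) + of_int (2 * k) * pi * \<i>"
      using assms[of i] unfolding xy torus_char_proj exp_eq by blast
    then have "2 * pi * \<i> * of_real (x $ i) = 2 * pi * \<i> * (of_real (y $ i) + of_int k)"
      by (simp add: algebra_simps)
    then have "complex_of_real (x $ i) = of_real (y $ i) + of_int k"
      by simp
    then have "x $ i = y $ i + of_int k"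
      by (metis of_real_add of_real_eq_iff of_real_of_int_eq)
    then show ?thesis by simp
  qed
  then show ?thesis by (simp add: xy torus.abs_eq_iff int_translate_def)
qed

section \<open>Lifts to the plane and classes of loops\<close>

text \<open>
  The plane is contractible, so the functions \<open>torus_char i \<circ> f \<circ> proj\<close> have continuous logarithms.
  They are purely imaginary because characters have modulus 1, and their imaginary parts divided by \<open>2\<pi>\<close> are the coordinates
  of the lift.
\<close>

lemma continuous_lift_exists:
  assumes f: "continuous_on UNIV (f :: torus \<Rightarrow> torus)"
  obtains F where "continuous_on UNIV F" "\<And>x. proj (F x) = f (proj x)"
proof -
  have "\<exists>g. continuous_on UNIV g \<and> (\<forall>x. torus_char i (f (proj x)) = exp (g x))" for i
  proof -
    have "continuous_on UNIV (\<lambda>x. torus_char i (f (proj x)))"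
      by (intro continuous_on_compose2[OF continuous_on_torus_char]
           continuous_on_compose2[OF f] continuous_intros) auto
    then show ?thesis
      using continuous_logarithm_on_contractible[of UNIV "\<lambda>x. torus_char i (f (proj x))"]
        convex_imp_contractible[OF convex_UNIV] by (metis UNIV_I torus_char_nonzero)
  qed
  then obtain g where g: "\<And>i. continuous_on UNIV (g i)"
     "\<And>i x. torus_char i (f (proj x)) = exp (g i x)"
    by metis
  define F where "F x = (\<chi> i. Im (g i x) / (2 * pi))" for x
  show thesis
  proof
    show "continuous_on UNIV F"
      unfolding F_def by (intro continuous_intros g) auto
    fix x
    show "proj (F x) = f (proj x)"
    proof (rule torus_eqI)
      fix i
      obtain y where y: "f (proj x) = proj y" by (metis torus_cases)
      have "exp (Re (g i x)) = 1"
        using arg_cong[OF g(2)[of i x], of norm] 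
        by (simp add: y torus_char_proj)
      then have "g i x = 2 * pi * \<i> * of_real (F x $ i)"
        by (simp add: F_def complex_eq_iff)
      then show "torus_char i (proj (F x)) = torus_char i (f (proj x))"
        by (simp add: torus_char_proj g)
    qed
  qed
qed

text \<open>
  Monodromy, one coordinate at a time: the character \<open>torus_char i\<close> maps the homotopy into the punctured plane,
  where the exponential map is a covering, and lifts of homotopic paths end at the same point if
  they begin at the same point.
\<close>

lemma homotopic_proj_displacement:
  assumes "path g" "path h" and hom: "homotopic_paths UNIV (proj \<circ> g) (proj \<circ> h)"
  shows "pathfinish g - pathstart g = pathfinish h - pathstart h"
proof -
  have "(pathfinish g - pathstart g) $ i = (pathfinish h - pathstart h) $ i" for i
  proof -
    have "proj (pathstart g) = proj (pathstart h)"
      using homotopic_paths_imp_pathstart[OF hom] by (simp add: pathstart_def)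
    then obtain v where v: "pathstart g = pathstart h + of_ivec v"
      by (auto simp: proj_eq_iff)
    \<comment> \<open>The shift by \<open>v\<close> in \<open>lh\<close> makes the two logarithms start at the same point.\<close>
    define lg where "lg = (\<lambda>t. 2 * pi * \<i> * of_real (g t $ i))"
    define lh where "lh = (\<lambda>t. 2 * pi * \<i> * of_real ((h t + of_ivec v) $ i))"
    have exps: "exp (lg t) = (torus_char i \<circ> (proj \<circ> g)) t" 
      "exp (lh t) = (torus_char i \<circ> (proj \<circ> h)) t" for t
      unfolding lg_def lh_def torus_char_proj[symmetric] by auto
    have "pathfinish lg = pathfinish lh"
    proof (rule covering_space_monodromy[OF covering_space_exp_punctured_plane])
      show hom': "homotopic_paths (- {0}) (torus_char i \<circ> (proj \<circ> g)) (torus_char i \<circ> (proj \<circ> h))"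
        by (rule homotopic_paths_continuous_image[OF hom continuous_on_torus_char]) auto
      show "path (torus_char i \<circ> (proj \<circ> g))" "path (torus_char i \<circ> (proj \<circ> h))"
        using homotopic_paths_imp_path[OF hom'] by auto
      show "path_image (torus_char i \<circ> (proj \<circ> g)) \<subseteq> - {0}" "path_image (torus_char i \<circ> (proj \<circ> h)) \<subseteq> - {0}"
        using homotopic_paths_imp_subset[OF hom'] by auto
      show "path lg" "path lh"
        using assms(1,2) unfolding lg_def lh_def path_def by (intro continuous_intros; simp)+
    qed (use v exps in \<open>auto simp: pathstart_def lg_def lh_def\<close>)
    then have "complex_of_real (pathfinish g $ i) = of_real ((pathfinish h + of_ivec v) $ i)"
      by (simp add: pathfinish_def lg_def lh_def)
    then have "pathfinish g $ i = (pathfinish h + of_ivec v) $ i"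
      by (metis of_real_eq_iff)
    then show ?thesis by (simp add: v)
  qed
  then show ?thesis by (simp add: vec_eq_iff)
qed

text \<open>
  Both directions use the displacement of a lifted path.  It is a homotopy invariant by the previous
  lemma, and conversely a path in the plane can be deformed to the segment with the same ends.
\<close>

lemma has_loop_class_proj_iff:
  assumes "path g"
  shows "has_loop_class (proj \<circ> g) v \<longleftrightarrow> pathfinish g = pathstart g + of_ivec v"
proof
  assume "has_loop_class (proj \<circ> g) v"
  then obtain x where "homotopic_paths UNIV (proj \<circ> g) (proj \<circ> linepath x (x + of_ivec v))"
    unfolding has_loop_class_def of_ivec_def by blast
  from homotopic_proj_displacement[OF assms _ this]
  show "pathfinish g = pathstart g + of_ivec v" by (simp add: algebra_simps)
next
  assume e: "pathfinish g = pathstart g + of_ivec v"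
  have "homotopic_paths UNIV g (linepath (pathstart g) (pathstart g + of_ivec v))"
    by (rule homotopic_paths_linear) (use assms e in auto)
  then have "homotopic_paths UNIV (proj \<circ> g) (proj \<circ> linepath (pathstart g) (pathstart g + of_ivec v))"
    by (rule homotopic_paths_continuous_image) (auto intro: continuous_intros)
  then show "has_loop_class (proj \<circ> g) v"
    unfolding has_loop_class_def of_ivec_def by (auto simp: pathstart_def)
qed

lemma of_ivec_matrix_mult: "of_ivec (A *v v) = map_matrix real_of_int A *v of_ivec v"
  by (simp add: vec_eq_iff matrix_vector_mult_def map_matrix_def)

text \<open>
  The segment from \<open>x\<close> to \<open>x + v\<close> projects to a loop of class \<open>v\<close>; its image under \<open>F\<close> lifts
  the image loop, whose class is \<open>A v\<close> by definition of the linear part.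
\<close>

lemma lift_translate:
  assumes F: "continuous_on UNIV F" "\<And>x. proj (F x) = f (proj x)" and A: "is_linear_part f A"
  shows "F (x + of_ivec v) = F x + of_ivec (A *v v)"
proof -
  let ?g = "linepath x (x + of_ivec v)"
  have "has_loop_class (proj \<circ> ?g) v"
    by (subst has_loop_class_proj_iff) auto
  then have "has_loop_class (f \<circ> (proj \<circ> ?g)) (A *v v)"
    using A unfolding is_linear_part_def by blast
  also have "f \<circ> (proj \<circ> ?g) = proj \<circ> (F \<circ> ?g)"
    using F(2) by auto
  finally have "pathfinish (F \<circ> ?g) = pathstart (F \<circ> ?g) + of_ivec (A *v v)"
    by (subst (asm) has_loop_class_proj_iff) 
      (auto intro!: path_continuous_image continuous_on_subset[OF F(1)])
  then show ?thesis by (simp add: pathfinish_def pathstart_def linepath_def)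
qed

lemma periodic_imp_bounded:
  fixes h :: "real ^ 2 \<Rightarrow> 'a::real_normed_vector"
  assumes h: "continuous_on UNIV h" "\<And>x v. h (x + of_ivec v) = h x"
  obtains K where "\<And>x. norm (h x) \<le> K"
proof -
  have "compact (h ` cbox 0 1)"
    by (intro compact_continuous_image continuous_on_subset[OF h(1)]) auto
  then obtain K where K: "\<And>x. x \<in> cbox 0 1 \<Longrightarrow> norm (h x) \<le> K"
    by (meson bounded_iff compact_imp_bounded imageI)
  have "norm (h x) \<le> K" for x
  proof -
    define v where "v = (\<chi> i. \<lfloor>x $ i\<rfloor>)"
    have "x - of_ivec v \<in> cbox 0 1"
      unfolding mem_box_cart v_def by (auto simp: algebra_simps; linarith)
    then show ?thesis
      using K h(2)[of "x - of_ivec v" v] by force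
  qed
  then show thesis using that by blast
qed

section \<open>Lifts of local diffeomorphisms\<close>

text \<open>
  The definition allows any representative of the point and any local lift \<open>F\<close>.  After translation
  of the representative to \<open>x\<close>, the difference between \<open>F\<close> and the global lift \<open>G\<close> is integer-valued near \<open>x\<close> and continuous at \<open>x\<close>,
  hence constant near \<open>x\<close>, so both have the same derivative.
\<close>

lemma has_torus_derivative_iff_lift:
  assumes G: "continuous_on UNIV G" "\<And>x. proj (G x) = g (proj x)"
  shows "has_torus_derivative g D (proj x) \<longleftrightarrow> (G has_derivative (\<lambda>h. D *v h)) (at x)"
proof
  assume "(G has_derivative (\<lambda>h. D *v h)) (at x)"
  then show "has_torus_derivative g D (proj x)"
    unfolding has_torus_derivative_def using G(2)
    by (intro exI[of _ x] exI[of _ G]) simp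
next
  assume "has_torus_derivative g D (proj x)"
  then obtain x' F where x': "proj x' = proj x" and F: "\<forall>\<^sub>F y in nhds x'. proj (F y) = g (proj y)"
    and der: "(F has_derivative (\<lambda>h. D *v h)) (at x')"
    unfolding has_torus_derivative_def by blast
  obtain v where v: "x' = x + of_ivec v"
    using x' by (auto simp: proj_eq_iff)
  define H where "H y = F (y + of_ivec v)" for y
  have "((\<lambda>y. y + of_ivec v) has_derivative (\<lambda>h. h)) (at x)"
    by (auto intro!: derivative_eq_intros)
  then have H: "(H has_derivative (\<lambda>h. D *v h)) (at x)"
    unfolding H_def using der has_derivative_compose[of "\<lambda>y. y + of_ivec v" "\<lambda>h. h" x UNIV F] by (simp add: v)
  define d where "d y = H y - G y" for y
  have "filterlim (\<lambda>y. y + of_ivec v) (nhds x') (nhds x)"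
    unfolding v by (intro tendsto_intros filterlim_ident)
  from eventually_compose_filterlim[OF F this]
  have "\<forall>\<^sub>F y in nhds x. proj (H y) = proj (G y)"
    by (simp add: H_def G(2))
  then have int: "\<forall>\<^sub>F y in nhds x. \<exists>w. d y = of_ivec w"
    by (rule eventually_mono) (auto simp: proj_eq_iff d_def)
  have "isCont G x"
    using G(1) by (simp add: continuous_on_eq_continuous_at)
  then have "isCont d x"
    unfolding d_def using has_derivative_continuous[OF H] by (intro continuous_diff)
  then have "(d \<longlongrightarrow> d x) (nhds x)"
    by (simp add: continuous_at tendsto_at_iff_tendsto_nhds)
  then have "\<forall>\<^sub>F y in nhds x. dist (d y) (d x) < 1"
    by (rule tendstoD) simp
  then have "\<forall>\<^sub>F y in nhds x. d y = d x"
    using int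
  proof eventually_elim
    case (elim y)
    obtain w where "d y = of_ivec w" using elim(2) by blast
    moreover obtain w' where "d x = of_ivec w'"
      using eventually_nhds_x_imp_x[OF int] by blast
    ultimately show ?case
      using of_ivec_close_imp_eq elim(1) by metis
  qed
  then have "\<forall>\<^sub>F y in nhds x. H y - d x = G y"
    by eventually_elim (simp add: d_def algebra_simps)
  then have ev: "\<forall>\<^sub>F y in at x. H y - d x = G y"
    by (simp add: eventually_nhds_conv_at)
  have "((\<lambda>y. H y - d x) has_derivative (\<lambda>h. D *v h)) (at x)"
    using H by (auto intro!: derivative_eq_intros)
  from has_derivative_transform_eventually[OF this ev]
  show "(G has_derivative (\<lambda>h. D *v h)) (at x)" by (simp add: d_def)
qed

lemma has_derivative_torus_deriv:
  assumes G: "continuous_on UNIV G" "\<And>x. proj (G x) = g (proj x)"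
    and "G differentiable at x"
  shows "(G has_derivative (\<lambda>h. torus_deriv g (proj x) *v h)) (at x)"
proof -
  obtain G' where G': "(G has_derivative G') (at x)"
    using assms(3) by (auto simp: differentiable_def)
  have M: "(G has_derivative (\<lambda>h. matrix G' *v h)) (at x)"
    using G' has_derivative_linear[OF G'] by (simp add: matrix_works)
  have "has_torus_derivative g D (proj x) \<longleftrightarrow> D = matrix G'" for D
    unfolding has_torus_derivative_iff_lift[OF G]
    using M has_derivative_unique[of G "\<lambda>h. D *v h" x "\<lambda>h. matrix G' *v h"]
    by (metis matrix_eq)
  then have "torus_deriv g (proj x) = matrix G'"
    by (simp add: torus_deriv_def)
  with M show ?thesis by simp
qed

lemma C1_local_diffeoE:
  assumes "C1_local_diffeo f"
  obtains U V g where "open U" "p \<in> U" "homeomorphism U V f g" "torus_C1_on U f"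
proof -
  have "\<exists>U V g. open U \<and> p \<in> U \<and> open V \<and> homeomorphism U V f g \<and> torus_C1_on U f \<and> torus_C1_on V g"
    using assms unfolding C1_local_diffeo_def by (rule spec)
  then show thesis
    by (elim exE conjE) (rule that)
qed

lemma C1_local_diffeo_imp_continuous:
  assumes "C1_local_diffeo f" shows "continuous_on UNIV f"
proof -
  let ?\<U> = "{U. open U \<and> continuous_on U f}"
  have "p \<in> \<Union>?\<U>" for p
  proof -
    obtain U V g where "open U" "p \<in> U" "homeomorphism U V f g"
      by (rule C1_local_diffeoE[OF assms, of p])
    then show ?thesis
      using homeomorphism_cont1 by (intro UnionI[of U]) auto
  qed
  then have "\<Union>?\<U> = UNIV" by blast
  moreover have "continuous_on (\<Union>?\<U>) f"
    by (rule continuous_on_open_Union) auto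
  ultimately show ?thesis by (simp only:)
qed

lemma lift_differentiable:
  assumes "C1_local_diffeo f" "continuous_on UNIV F" "\<And>x. proj (F x) = f (proj x)"
  shows "F differentiable at x"
proof -
  obtain U Df where "proj x \<in> U" "\<forall>p\<in>U. has_torus_derivative f (Df p) p"
    by (rule C1_local_diffeoE[OF assms(1), of "proj x"]) (auto simp: torus_C1_on_def)
  then show ?thesis
    using has_torus_derivative_iff_lift[of F f, OF assms(2,3)] by (auto simp: differentiable_def)
qed

text \<open>
  A ball of radius \<open>1 / 2\<close> contains no two distinct points that differ by an integer vector.
\<close>

lemma lift_locally_inj:
  assumes "C1_local_diffeo f" and F: "continuous_on UNIV F" "\<And>x. proj (F x) = f (proj x)"
  shows "\<exists>U. open U \<and> x \<in> U \<and> inj_on F U"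
proof -
  obtain U V g where U: "open U" "proj x \<in> U" "homeomorphism U V f g"
    by (rule C1_local_diffeoE[OF assms(1), of "proj x"])
  define O' where "O' = proj -` U \<inter> ball x (1/2)"
  have "inj_on F O'"
  proof (rule inj_onI)
    fix y z assume yz: "y \<in> O'" "z \<in> O'" "F y = F z"
    then have "f (proj y) = f (proj z)"
      by (metis F(2))
    then have "proj y = proj z"
      using yz U(3) unfolding homeomorphism_def O'_def by (metis IntD1 vimage_eq)
    then obtain v where v: "y = z + of_ivec v"
      by (auto simp: proj_eq_iff)
    have "dist y z < 1"
      using yz dist_triangle_half_r[of x y 1 z] by (auto simp: O'_def)
    then have "v = 0"
      using of_ivec_close_imp_eq[of v 0] by (simp add: v dist_norm)
    then show "y = z" by (simp add: v)
  qed
  moreover have "open O'"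
    using U(1) by (simp add: O'_def open_torus_def open_Int)
  ultimately show ?thesis
    using U(2) by (intro exI[of _ O']) (auto simp: O'_def)
qed

text \<open>
  Invariance of domain, applied to the pieces on which the map is injective.
\<close>

lemma locally_inj_imp_open_map:
  fixes F :: "'a::euclidean_space \<Rightarrow> 'a"
  assumes F: "continuous_on UNIV F" and inj: "\<And>x. \<exists>U. open U \<and> x \<in> U \<and> inj_on F U"
    and "open S"
  shows "open (F ` S)"
proof -
  obtain U where U: "\<And>x. open (U x) \<and> x \<in> U x \<and> inj_on F (U x)"
    using inj by metis
  have "F ` S = (\<Union>x. F ` (S \<inter> U x))"
    using U by blast
  moreover have "open (F ` (S \<inter> U x))" for x
    by (rule invariance_of_domain)
       (use U \<open>open S\<close> in \<open>auto intro: continuous_on_subset[OF F] inj_on_subset\<close>)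
  ultimately show ?thesis by auto
qed

lemma open_map_of_lift:
  assumes "\<And>x. proj (F x) = f (proj x)" and "\<And>S. open S \<Longrightarrow> open (F ` S)" and "open U"
  shows "open (f ` U)"
proof -
  have "f ` U = proj ` F ` (proj -` U)"
  proof (intro equalityI subsetI)
    fix q assume "q \<in> f ` U"
    then obtain p where "p \<in> U" "q = f p" by blast
    moreover obtain x where "p = proj x" by (rule torus_cases)
    ultimately have "q = proj (F x)" "x \<in> proj -` U" by (simp_all add: assms(1))
    then show "q \<in> proj ` F ` (proj -` U)" by blast
  qed (auto simp: assms(1))
  moreover have "open (proj -` U)"
    using \<open>open U\<close> by (simp add: open_torus_def)
  ultimately show ?thesis
    using assms(2) open_proj_image by simp
qed

section \<open>Iterates\<close>

lemma lift_funpow: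
  assumes "\<And>x. proj (F x) = f (proj x)"
  shows "proj ((F ^^ n) x) = (f ^^ n) (proj x)"
  by (induction n) (simp_all add: assms)

lemma continuous_on_funpow:
  assumes "continuous_on UNIV (F :: 'a::topological_space \<Rightarrow> 'a)" shows "continuous_on UNIV (F ^^ n)"
proof (induction n)
  case (Suc n)
  then have "continuous_on UNIV (F \<circ> F ^^ n)"
    by (intro continuous_on_compose continuous_on_subset[OF assms]) auto
  then show ?case by simp
qed (simp add: id_def)

lemma differentiable_funpow:
  fixes F :: "'a::real_normed_vector \<Rightarrow> 'a"
  assumes "\<And>x. F differentiable at x" shows "(F ^^ n) differentiable at x"
proof (induction n)
  case (Suc n)
  then have "(F \<circ> F ^^ n) differentiable at x"
    by (intro differentiable_chain_at assms)
  then show ?case by (simp add: o_def)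
qed (simp add: id_def)

lemma open_funpow_image:
  fixes F :: "'a::topological_space \<Rightarrow> 'a"
  assumes "\<And>S. open S \<Longrightarrow> open (F ` S)" "open S" shows "open ((F ^^ n) ` S)"
proof (induction n)
  case (Suc n)
  then have "open (F ` (F ^^ n) ` S)" by (rule assms(1))
  then show ?case by (simp add: image_comp)
qed (simp add: assms(2))

section \<open>Proper local homeomorphisms are injective\<close>

lemma proper_continuous_imp_closed_map:
  fixes F :: "'a::euclidean_space \<Rightarrow> 'b::euclidean_space"
  assumes F: "continuous_on UNIV F" and proper: "\<And>K. compact K \<Longrightarrow> compact (F -` K)"
    and "closed C"
  shows "closed (F ` C)"
  unfolding closed_def
proof (rule openI)
  fix y assume y: "y \<in> - F ` C"
  have "compact (F ` (C \<inter> F -` cball y 1))"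
    using \<open>closed C\<close> proper by (intro compact_continuous_image continuous_on_subset[OF F] closed_Int_compact) auto
  then have "open (- F ` (C \<inter> F -` cball y 1))"
    by (simp add: compact_imp_closed open_Compl)
  then obtain e where e: "e > 0" "ball y e \<subseteq> - F ` (C \<inter> F -` cball y 1)"
    using y openE by (metis (no_types, lifting) ComplD ComplI image_iff Int_iff)
  then have "ball y (min e 1) \<subseteq> - F ` C"
    by (auto simp: subset_iff)
  then show "\<exists>T>0. ball y T \<subseteq> - F ` C"
    using \<open>e > 0\<close> by (intro exI[of _ "min e 1"]) auto
qed

text \<open>
  The fibre over a point \<open>y\<close> is compact and discrete, so it is finite, and its points have disjoint
  open neighbourhoods \<open>V x\<close> on which \<open>F\<close> is a homeomorphism onto an open set.  The image of the complement of
  these neighbourhoods is closed because \<open>F\<close> is proper, and it misses \<open>y\<close>.  Removing it leaves an evenly covered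
  neighbourhood of \<open>y\<close>.
\<close>

lemma proper_locally_inj_imp_covering_space:
  fixes F :: "'a::euclidean_space \<Rightarrow> 'a"
  assumes F: "continuous_on UNIV F" and inj: "\<And>x. \<exists>U. open U \<and> x \<in> U \<and> inj_on F U"
    and proper: "\<And>K. compact K \<Longrightarrow> compact (F -` K)"
  shows "covering_space UNIV F UNIV"
proof
  obtain U where U: "\<And>x. open (U x) \<and> x \<in> U x \<and> inj_on F (U x)"
    using inj by metis
  have opn: "open (F ` (S \<inter> U x))" if "open S" for S x
    by (rule invariance_of_domain)
       (use U that in \<open>auto intro: continuous_on_subset[OF F] inj_on_subset\<close>)
  note cls = proper_continuous_imp_closed_map[OF F proper]
  have "F ` UNIV = (\<Union>x. F ` (UNIV \<inter> U x))"
    using U by blast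
  moreover have "open \<dots>"
    by (rule open_UN) (blast intro: opn open_UNIV)
  ultimately have "open (F ` UNIV)" by (simp only:)
  moreover have "closed (F ` UNIV)" by (simp add: cls)
  ultimately show "F ` UNIV = UNIV"
    using clopen[of "F ` UNIV"] by blast
  show "continuous_on UNIV F" by fact
  fix y :: 'a
  define Z where "Z = F -` {y}"
  have "finite Z"
  proof -
    have "compact Z" unfolding Z_def by (rule proper) auto
    then obtain C where C: "C \<subseteq> Z" "finite C" "Z \<subseteq> (\<Union>c\<in>C. U c)"
      by (rule compactE_image[of Z Z U]) (use U in auto)
    have "Z \<subseteq> C"
    proof
      fix z assume "z \<in> Z"
      then obtain c where c: "c \<in> C" "z \<in> U c" using C by blast
      then have "F z = F c" using \<open>z \<in> Z\<close> C(1) by (auto simp: Z_def)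
      then show "z \<in> C" using U[of c] c by (metis inj_onD)
    qed
    then show ?thesis using C(2) finite_subset by blast
  qed
  obtain \<delta> where \<delta>: "\<And>x. \<delta> x > 0" "\<And>x z. z \<in> Z \<Longrightarrow> z \<noteq> x \<Longrightarrow> \<delta> x \<le> dist x z"
    using finite_set_avoid[OF \<open>finite Z\<close>] by metis
  \<comment> \<open>Half the distance to the nearest other point of the fibre makes the balls disjoint.\<close>
  define V where "V x = ball x (\<delta> x / 2) \<inter> U x" for x
  have V: "open (V x)" "x \<in> V x" "inj_on F (V x)" "open (F ` V x)" for x
    using U[of x] \<delta>(1)[of x] opn[of "ball x (\<delta> x / 2)" x]
    by (auto simp: V_def intro: inj_on_subset)
  have disj: "V x \<inter> V z = {}" if "x \<in> Z" "z \<in> Z" "x \<noteq> z" for x z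
  proof (rule ccontr)
    assume "V x \<inter> V z \<noteq> {}"
    then obtain w where "dist x w < \<delta> x / 2" "dist z w < \<delta> z / 2"
      by (auto simp: V_def)
    then show False
      using \<delta>(2)[of z x] \<delta>(2)[of x z] that dist_triangle2[of x z w] by (simp add: dist_commute)
  qed
  define T where "T = (\<Inter>x\<in>Z. F ` V x) - F ` (- (\<Union>x\<in>Z. V x))"
  have "open T"
    unfolding T_def using \<open>finite Z\<close> V
    by (intro open_Diff open_INT cls) (auto intro!: open_UN closed_Compl)
  moreover have "y \<in> T"
    using V(2) unfolding T_def by (auto simp: Z_def)
  moreover have "(\<Union>x\<in>Z. V x \<inter> F -` T) = F -` T"
    unfolding T_def by auto
  moreover have "open (V x \<inter> F -` T)" for x
    using V(1) \<open>open T\<close> F by (simp add: open_Int open_vimage)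
  moreover have "pairwise disjnt ((\<lambda>x. V x \<inter> F -` T) ` Z)"
    using disj unfolding pairwise_def disjnt_def by blast
  moreover have "\<exists>q. homeomorphism (V x \<inter> F -` T) T F q" if "x \<in> Z" for x
  proof -
    have "T \<subseteq> F ` V x"
      using that unfolding T_def by blast
    then have "F ` (V x \<inter> F -` T) = T" by blast
    then show ?thesis
      using invariance_of_domain_homeomorphism[of "V x \<inter> F -` T" F] \<open>open (V x \<inter> F -` T)\<close>
        continuous_on_subset[OF F] inj_on_subset[OF V(3)] by (metis Int_lower1 order_refl subset_UNIV)
  qed
  ultimately show "\<exists>T. y \<in> T \<and> openin (top_of_set UNIV) T \<and>
      (\<exists>v. \<Union>v = UNIV \<inter> F -` T \<and> (\<forall>u\<in>v. openin (top_of_set UNIV) u) \<and>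
        pairwise disjnt v \<and> (\<forall>u\<in>v. \<exists>q. homeomorphism u T F q))"
    by (intro exI[of _ T] conjI exI[of _ "(\<lambda>x. V x \<inter> F -` T) ` Z"]) auto
qed

text \<open>
  Lifting the identity through the covering gives a continuous section \<open>g\<close>.  Its range is open by
  invariance of domain, and closed because it is the set where \<open>g \<circ> F\<close> is the identity.  So \<open>g\<close> is
  onto, and \<open>F\<close> is its inverse.
\<close>

lemma covering_space_UNIV_imp_inj:
  fixes F :: "'a::euclidean_space \<Rightarrow> 'a"
  assumes cov: "covering_space UNIV F UNIV"
  shows "inj F"
proof -
  obtain g where g: "continuous_on UNIV g" "\<And>y. F (g y) = y"
    using covering_space_lift[OF cov convex_imp_simply_connected[OF convex_UNIV]
        locally_path_connected_UNIV continuous_on_id] by auto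
  have "open (range g)"
    by (rule invariance_of_domain[OF g(1)]) (auto intro: inj_on_inverseI[of _ F] g(2))
  moreover have "range g = {x. g (F x) = x}"
    using g(2) by (auto, metis rangeI)
  moreover have "closed {x. g (F x) = x}"
    by (intro closed_Collect_eq continuous_on_compose2[OF g(1)]
        covering_space_imp_continuous[OF cov] continuous_on_id) auto
  ultimately have "range g = UNIV"
    using clopen[of "range g"] by auto
  then show ?thesis
    using g(2) by (metis injI surjD)
qed

text \<open>
  An injective linear map expands norms by at least a positive factor, so a map at bounded distance from it is proper.
\<close>

lemma locally_inj_near_linear_imp_inj:
  fixes F :: "'a::euclidean_space \<Rightarrow> 'a"
  assumes F: "continuous_on UNIV F" and inj: "\<And>x. \<exists>U. open U \<and> x \<in> U \<and> inj_on F U"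
    and T: "linear T" "inj T" and near: "\<And>x. norm (F x - T x) \<le> K"
  shows "inj F"
proof (intro covering_space_UNIV_imp_inj proper_locally_inj_imp_covering_space F inj)
  fix C :: "'a set" assume "compact C"
  then obtain R where R: "\<And>y. y \<in> C \<Longrightarrow> norm y \<le> R"
    by (meson bounded_iff compact_imp_bounded)
  obtain c where c: "c > 0" "\<And>x. c * norm x \<le> norm (T x)"
    using linear_inj_bounded_below_pos[OF T] by blast
  have "norm x \<le> (R + K) / c" if "x \<in> F -` C" for x
  proof -
    have "c * norm x \<le> norm (F x) + norm (F x - T x)"
      using c(2)[of x] norm_triangle_ineq4[of "F x" "F x - T x"] by simp
    also have "\<dots> \<le> R + K"
      using that R near[of x] by (intro add_mono) auto
    finally show ?thesis
      using c(1) by (simp add: pos_le_divide_eq mult.commute)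
  qed
  then have "bounded (F -` C)"
    by (meson boundedI)
  moreover have "closed (F -` C)"
    using F \<open>compact C\<close> by (simp add: compact_imp_closed closed_vimage)
  ultimately show "compact (F -` C)"
    by (simp add: compact_eq_bounded_closed)
qed

section \<open>Separation of orbits near a linear map\<close>

lemma eigenvalues_iff:
  "c \<in> eigenvalues A \<longleftrightarrow>
    (of_int (A $ 1 $ 1) - c) * (of_int (A $ 2 $ 2) - c) = of_int (A $ 1 $ 2) * of_int (A $ 2 $ 1)"
    (is "_ \<longleftrightarrow> (?a - c) * (?d - c) = ?b * ?e")
proof -
  have "c \<in> eigenvalues A \<longleftrightarrow>
      (\<exists>x y. (x \<noteq> 0 \<or> y \<noteq> 0) \<and> ?a * x + ?b * y = c * x \<and> ?e * x + ?d * y = c * y)"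
  proof
    assume "c \<in> eigenvalues A"
    then show "\<exists>x y. (x \<noteq> 0 \<or> y \<noteq> 0) \<and> ?a * x + ?b * y = c * x \<and> ?e * x + ?d * y = c * y"
      by (auto simp: eigenvalues_def vec_eq_iff forall_2 matrix_vector_mult_def sum_2 map_matrix_def)
  next
    assume "\<exists>x y. (x \<noteq> 0 \<or> y \<noteq> 0) \<and> ?a * x + ?b * y = c * x \<and> ?e * x + ?d * y = c * y"
    then obtain x y where "x \<noteq> 0 \<or> y \<noteq> 0" "?a * x + ?b * y = c * x" "?e * x + ?d * y = c * y"
      by blast
    then show "c \<in> eigenvalues A"
      unfolding eigenvalues_def
      by (auto intro!: exI[of _ "vector [x, y]"]
          simp: vec_eq_iff forall_2 matrix_vector_mult_def sum_2 map_matrix_def)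
  qed
  also have "\<dots> \<longleftrightarrow> (?a - c) * (?d - c) = ?b * ?e"
  proof
    assume "\<exists>x y. (x \<noteq> 0 \<or> y \<noteq> 0) \<and> ?a * x + ?b * y = c * x \<and> ?e * x + ?d * y = c * y"
    then obtain x y where xy: "x \<noteq> 0 \<or> y \<noteq> 0" "?a * x + ?b * y = c * x" "?e * x + ?d * y = c * y"
      by blast
    have "((?a - c) * (?d - c) - ?b * ?e) * x = 0" "((?a - c) * (?d - c) - ?b * ?e) * y = 0"
      using xy(2,3) by algebra+
    with xy(1) show "(?a - c) * (?d - c) = ?b * ?e" by auto
  next
    assume e: "(?a - c) * (?d - c) = ?b * ?e"
    \<comment> \<open>An eigenvector is orthogonal to both rows of the singular matrix \<open>A - c\<close>; rotate a nonzero
        row by a right angle, or take any vector if there is none.\<close>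
    show "\<exists>x y. (x \<noteq> 0 \<or> y \<noteq> 0) \<and> ?a * x + ?b * y = c * x \<and> ?e * x + ?d * y = c * y"
    proof (cases "?b = 0 \<and> c = ?a")
      case False
      then show ?thesis
        using e by (intro exI[of _ "?b"] exI[of _ "c - ?a"]) (auto simp: algebra_simps)
    next
      case True
      show ?thesis
      proof (cases "c = ?d \<and> ?e = 0")
        case False
        then show ?thesis
          using True by (intro exI[of _ "c - ?d"] exI[of _ "?e"]) (auto simp: algebra_simps)
      next
        case c: True
        then show ?thesis
          using True by (intro exI[of _ 1] exI[of _ 0]) simp
      qed
    qed
  qed
  finally show ?thesis .
qed

text \<open>
  If \<open>l1 \<noteq> l2\<close>, subtracting the two characteristic equations gives the trace.  If \<open>l1 = l2\<close>, the
  multiplicity comes from the second root, trace minus \<open>l1\<close>: it also belongs to the given set, so it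
  equals \<open>l1\<close>.
\<close>

lemma eigenvalues_trace_det:
  assumes "eigenvalues A = {of_int l1, of_int l2}"
  shows "A $ 1 $ 1 + A $ 2 $ 2 = l1 + l2"
    and "A $ 1 $ 1 * A $ 2 $ 2 - A $ 1 $ 2 * A $ 2 $ 1 = l1 * l2"
proof -
  define t where "t = A $ 1 $ 1 + A $ 2 $ 2"
  define \<delta> where "\<delta> = A $ 1 $ 1 * A $ 2 $ 2 - A $ 1 $ 2 * A $ 2 $ 1"
  have root: "complex_of_int k \<in> eigenvalues A \<longleftrightarrow> k * k - t * k + \<delta> = 0" for k
  proof -
    have "complex_of_int k \<in> eigenvalues A \<longleftrightarrow> 
       complex_of_int ((A $ 1 $ 1 - k) * (A $ 2 $ 2 - k)) = complex_of_int (A $ 1 $ 2 * A $ 2 $ 1)"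
      by (simp add: eigenvalues_iff)
    also have "\<dots> \<longleftrightarrow> k * k - t * k + \<delta> = 0"
      unfolding of_int_eq_iff t_def \<delta>_def by (simp add: algebra_simps)
    finally show ?thesis .
  qed
  have r1: "l1 * l1 - t * l1 + \<delta> = 0" and r2: "l2 * l2 - t * l2 + \<delta> = 0"
    using assms by (auto simp flip: root)
  have "(t - l1) * (t - l1) - t * (t - l1) + \<delta> = 0"
    using r1 by (simp add: algebra_simps)
  then have "complex_of_int (t - l1) \<in> {of_int l1, of_int l2}"
    unfolding assms[symmetric] root .
  then have "t - l1 = l1 \<or> t - l1 = l2"
    by (metis empty_iff insert_iff of_int_eq_iff)
  moreover have "(l1 - l2) * (l1 + l2 - t) = 0"
    using r1 r2 by (simp add: algebra_simps)
  ultimately have t: "t = l1 + l2" by auto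
  then show "A $ 1 $ 1 + A $ 2 $ 2 = l1 + l2" by (simp add: t_def)
  show "A $ 1 $ 1 * A $ 2 $ 2 - A $ 1 $ 2 * A $ 2 $ 1 = l1 * l2"
    using r1 unfolding t \<delta>_def by (simp add: algebra_simps)
qed

lemma Cayley_Hamilton_2:
  fixes x :: "real ^ 2"
  assumes "eigenvalues A = {of_int l1, of_int l2}" and "M = map_matrix real_of_int A"
  shows "M *v (M *v x) = real_of_int (l1 + l2) *\<^sub>R (M *v x) - real_of_int (l1 * l2) *\<^sub>R x"
proof -
  have t: "real_of_int (l1 + l2) = M $ 1 $ 1 + M $ 2 $ 2"
    and d: "real_of_int (l1 * l2) = M $ 1 $ 1 * M $ 2 $ 2 - M $ 1 $ 2 * M $ 2 $ 1"
    unfolding eigenvalues_trace_det[OF assms(1), symmetric] assms(2) by (simp_all add: map_matrix_def)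
  show ?thesis
    unfolding t d by (simp add: vec_eq_iff forall_2 matrix_vector_mult_def sum_2 algebra_simps)
qed

text \<open>
  By the quadratic relation, \<open>T - b\<close> maps into the kernel of \<open>T - a\<close>.  So the vectors \<open>T (d n) - b d n\<close> satisfy a perturbed
  one-dimensional recursion with factor \<open>a\<close> and are of order \<open>\<bar>a\<bar>\<^sup>n\<close>.
  Then \<open>d (n + 1)\<close> equals \<open>b d n\<close> up to an error of that order; as \<open>\<bar>b\<bar> \<le> \<bar>a\<bar>\<close>, each step
  adds at most one more multiple of \<open>\<bar>a\<bar>\<^sup>n\<close>, which produces the factor \<open>1 + n\<close>.  The constant
  \<open>R\<close> is chosen before the sequence \<open>d\<close>, which gives a bound uniform over all pairs of orbits.
\<close>

lemma perturbed_orbit_growth: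
  fixes T :: "'a::real_normed_vector \<Rightarrow> 'a"
  assumes T: "bounded_linear T"
    and CH: "\<And>x. T (T x) = (a + b) *\<^sub>R T x - (a * b) *\<^sub>R x"
    and ab: "2 \<le> \<bar>a\<bar>" "\<bar>b\<bar> \<le> \<bar>a\<bar>" and "0 \<le> K"
  obtains R where "0 \<le> R"
    "\<And>d n. norm (d 0) \<le> \<delta> \<Longrightarrow> (\<And>n. norm (d (Suc n) - T (d n)) \<le> K) \<Longrightarrow>
        norm (d n) \<le> R * (1 + real n) * \<bar>a\<bar> ^ n"
proof -
  interpret T: bounded_linear T by fact
  let ?S = "\<lambda>x. T x - b *\<^sub>R x"
  obtain B where B: "B > 0" "\<And>x. norm (?S x) \<le> norm x * B"
  proof -
    have "bounded_linear ?S"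
      using bounded_linear_sub[OF T bounded_linear_scaleR_right] .
    then show thesis using that bounded_linear.pos_bounded by blast
  qed
  define P where "P = \<bar>\<delta>\<bar> * B + K * B"
  define R where "R = \<bar>\<delta>\<bar> + P + K"
  have P0: "0 \<le> P"
    using B(1) \<open>0 \<le> K\<close> by (simp add: P_def)
  show thesis
  proof (rule that[of R])
    show R0: "0 \<le> R" using P0 \<open>0 \<le> K\<close> by (simp add: R_def)
    fix d :: "nat \<Rightarrow> 'a" and n
    assume d0: "norm (d 0) \<le> \<delta>" and dK: "\<And>n. norm (d (Suc n) - T (d n)) \<le> K"
    \<comment> \<open>The extra term \<open>K * B\<close> absorbs the perturbation at each step, because \<open>\<bar>a\<bar> \<ge> 2\<close>.\<close>
    have S: "norm (?S (d n)) + K * B \<le> P * \<bar>a\<bar> ^ n" for n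
    proof (induction n)
      case 0
      have "norm (d 0) * B \<le> \<bar>\<delta>\<bar> * B"
        using d0 B(1) by (intro mult_right_mono) auto
      then show ?case
        using B(2)[of "d 0"] by (simp add: P_def)
    next
      case (Suc n)
      define r where "r = d (Suc n) - T (d n)"
      have ds: "d (Suc n) = T (d n) + r" by (simp add: r_def)
      have "?S (d (Suc n)) = a *\<^sub>R ?S (d n) + ?S r"
        unfolding ds T.add CH by (simp add: algebra_simps)
      then have "norm (?S (d (Suc n))) \<le> \<bar>a\<bar> * norm (?S (d n)) + norm (?S r)"
        using norm_triangle_ineq[of "a *\<^sub>R ?S (d n)" "?S r"] by simp
      moreover have "norm (?S r) \<le> K * B"
      proof -
        have "norm r * B \<le> K * B"
          using dK[of n] B(1) by (intro mult_right_mono) (auto simp: r_def)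
        with B(2)[of r] show ?thesis by linarith
      qed
      moreover have "2 * (K * B) \<le> \<bar>a\<bar> * (K * B)"
        using ab(1) \<open>0 \<le> K\<close> B(1) by (intro mult_right_mono) auto
      ultimately have "norm (?S (d (Suc n))) + K * B \<le> \<bar>a\<bar> * (norm (?S (d n)) + K * B)"
        by (simp add: distrib_left)
      also have "\<dots> \<le> \<bar>a\<bar> * (P * \<bar>a\<bar> ^ n)"
        by (intro mult_left_mono Suc) auto
      finally show ?case by (simp add: mult_ac)
    qed
    show "norm (d n) \<le> R * (1 + real n) * \<bar>a\<bar> ^ n"
    proof (induction n)
      case 0
      show ?case using d0 P0 \<open>0 \<le> K\<close> by (simp add: R_def)
    next
      case (Suc n)
      define r where "r = d (Suc n) - T (d n)"
      have "d (Suc n) = b *\<^sub>R d n + (?S (d n) + r)" by (simp add: r_def)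
      then have "norm (d (Suc n)) \<le> \<bar>b\<bar> * norm (d n) + (norm (?S (d n)) + norm r)"
        using norm_triangle_ineq[of "b *\<^sub>R d n" "?S (d n) + r"] norm_triangle_ineq[of "?S (d n)" r]
        by simp
      moreover have "\<bar>b\<bar> * norm (d n) \<le> \<bar>a\<bar> * (R * (1 + real n) * \<bar>a\<bar> ^ n)"
        using Suc ab by (intro mult_mono) auto
      moreover have "norm (?S (d n)) \<le> P * \<bar>a\<bar> ^ n"
        using S[of n] mult_nonneg_nonneg[of K B] \<open>0 \<le> K\<close> B(1) by linarith
      moreover have "norm r \<le> K * \<bar>a\<bar> ^ n"
      proof -
        have "K * 1 \<le> K * \<bar>a\<bar> ^ n"
          using ab(1) \<open>0 \<le> K\<close> by (intro mult_left_mono one_le_power) auto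
        then show ?thesis using dK[of n] by (simp add: r_def)
      qed
      moreover have "P * \<bar>a\<bar> ^ n + K * \<bar>a\<bar> ^ n \<le> R * \<bar>a\<bar> ^ Suc n"
      proof -
        have "(P + K) * \<bar>a\<bar> ^ n \<le> R * \<bar>a\<bar> ^ Suc n"
          using ab R0 \<open>0 \<le> K\<close> P0
          by (intro mult_mono power_increasing) (auto simp: R_def)
        then show ?thesis by (simp add: distrib_right)
      qed
      ultimately have "norm (d (Suc n)) \<le> \<bar>a\<bar> * (R * (1 + real n) * \<bar>a\<bar> ^ n) + R * \<bar>a\<bar> ^ Suc n"
        by linarith
      then show ?case by (simp add: algebra_simps)
    qed
  qed
qed

lemma linear_times_exponential_eventually_less:
  fixes L \<mu> c R :: real
  assumes "0 \<le> L" "L < \<mu>" "0 < c"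
  shows "\<forall>\<^sub>F n in sequentially. R * (1 + real n) * L ^ n < c * \<mu> ^ n"
proof -
  define q where "q = L / \<mu>"
  have q: "norm q < 1" using assms by (simp add: q_def)
  have "(\<lambda>n. R * (q ^ n + of_nat n * q ^ n)) \<longlonglongrightarrow> R * (0 + 0)"
    by (intro tendsto_intros LIMSEQ_power_zero powser_times_n_limit_0 q)
  then have "(\<lambda>n. R * (q ^ n + of_nat n * q ^ n)) \<longlonglongrightarrow> 0" by simp
  then have "\<forall>\<^sub>F n in sequentially. R * (q ^ n + of_nat n * q ^ n) < c"
    using \<open>0 < c\<close> by (rule order_tendstoD(2))
  then show ?thesis
  proof eventually_elim
    case (elim n)
    have "\<mu> ^ n > 0" using assms by simp
    then have "R * (q ^ n + of_nat n * q ^ n) * \<mu> ^ n < c * \<mu> ^ n"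
      using elim by simp
    moreover have "q ^ n * \<mu> ^ n = L ^ n"
      using assms by (simp add: q_def power_divide)
    ultimately show ?case
      by (simp add: algebra_simps)
  qed
qed

section \<open>Area of images and of disjoint translates\<close>

text \<open>
  Change of variables; the Jacobian is integrable over \<open>S\<close> because the image has finite measure.
\<close>

lemma measure_injective_image_ge:
  fixes G :: "real ^ 'n::{finite,wellorder} \<Rightarrow> real ^ 'n::_"
  assumes S: "S \<in> lmeasurable" and GS: "G ` S \<in> lmeasurable" and inj: "inj_on G S"
    and der: "\<And>x. x \<in> S \<Longrightarrow> (G has_derivative G' x) (at x)"
    and c: "\<And>x. x \<in> S \<Longrightarrow> c \<le> \<bar>det (matrix (G' x))\<bar>"
  shows "c * measure lebesgue S \<le> measure lebesgue (G ` S)"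
proof -
  let ?J = "\<lambda>x. \<bar>det (matrix (G' x))\<bar>"
  have S': "S \<in> sets lebesgue" using S by (simp add: fmeasurableD)
  have der': "(G has_derivative G' x) (at x within S)" if "x \<in> S" for x
    using der[OF that] by (rule has_derivative_at_withinI)
  \<comment> \<open>The change of variables theorem concerns vector-valued integrands, hence the detour
      through one-dimensional vectors.\<close>
  have "(\<lambda>x. 1 :: real ^ 1) absolutely_integrable_on (G ` S)"
    by (intro absolutely_integrable_onI integrable_on_const GS)
  then have "(\<lambda>x. ?J x *\<^sub>R (1 :: real ^ 1)) absolutely_integrable_on S"
    using has_absolute_integral_change_of_variables[OF S' der' inj, of "\<lambda>x. 1 :: real ^ 1"] by blast
  then have "(\<lambda>x. (?J x *\<^sub>R (1 :: real ^ 1)) \<bullet> axis 1 1) integrable_on S"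
    by (intro integrable_component set_lebesgue_integral_eq_integral(1))
  then have J: "?J integrable_on S"
    by (simp add: inner_axis)
  have "c * measure lebesgue S = integral S (\<lambda>x. c)"
    using integral_mult_right[of S c "\<lambda>x. 1::real"] lmeasure_integral[OF S] by simp
  also have "\<dots> \<le> integral S ?J"
    by (intro integral_le integrable_on_const S J c)
  also have "\<dots> = measure lebesgue (G ` S)"
    by (rule measure_differentiable_image_eq[OF S' der' inj J, symmetric])
  finally show ?thesis .
qed

text \<open>
  The translates of \<open>W\<close> by \<open>0, \<dots>, J\<close> times the basis vector are pairwise disjoint, have equal area, and lie
  in a box with sides \<open>2D\<close> and \<open>2D + J\<close>.  Hence \<open>(1 + J)\<close> times the area of \<open>W\<close> is at most
  \<open>2D(2D + J)\<close>, and \<open>J \<ge> 2D\<close> gives the bound.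
\<close>

lemma measure_le_of_disjoint_translates:
  fixes W :: "(real ^ 2) set"
  assumes W: "W \<in> lmeasurable" "W \<noteq> {}" and D: "\<And>x y. x \<in> W \<Longrightarrow> y \<in> W \<Longrightarrow> norm (x - y) \<le> D"
    and disj: "\<And>j :: nat. j > 0 \<Longrightarrow> W \<inter> (+) (of_nat j *\<^sub>R axis k 1) ` W = {}"
  shows "measure lebesgue W \<le> 4 * D"
proof -
  obtain w where w: "w \<in> W" using \<open>W \<noteq> {}\<close> by blast
  then have "0 \<le> D" using D[of w w] by simp
  define J where "J = nat \<lceil>2 * D\<rceil>"
  have J: "2 * D \<le> real J" unfolding J_def by (rule real_nat_ceiling_ge)
  define e :: "real ^ 2" where "e = axis k 1"
  define t where "t j = (+) (real j *\<^sub>R e) ` W" for j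
  define Q where "Q = cbox (w - (\<chi> i. D)) (w + (\<chi> i. D) + real J *\<^sub>R e)"
  have tm: "t j \<in> lmeasurable" "measure lebesgue (t j) = measure lebesgue W" for j
    unfolding t_def using W by (simp_all add: measurable_translation measure_translation)
  have less: "t i \<inter> t j = {}" if "i < j" for i j
  proof (rule ccontr)
    assume "t i \<inter> t j \<noteq> {}"
    then obtain x y where "x \<in> W" "y \<in> W" "real i *\<^sub>R e + x = real j *\<^sub>R e + y"
      by (auto simp: t_def)
    then have "x = real (j - i) *\<^sub>R e + y" 
      using that by (simp add: of_nat_diff algebra_simps)
    then have "x \<in> W \<inter> (+) (of_nat (j - i) *\<^sub>R axis k 1) ` W"
      using \<open>x \<in> W\<close> \<open>y \<in> W\<close> by (auto simp: e_def)
    then show False using disj[of "j - i"] that by auto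
  qed
  have "pairwise (\<lambda>i j. disjnt (t i) (t j)) {..J}"
    unfolding pairwise_def disjnt_def using less by (metis Int_commute nat_neq_iff)
  then have "measure lebesgue (\<Union>j\<le>J. t j) = (\<Sum>j\<le>J. measure lebesgue (t j))"
    by (intro measure_UNION') (auto simp: tm)
  also have "\<dots> = (1 + real J) * measure lebesgue W"
    by (simp add: tm)
  finally have "(1 + real J) * measure lebesgue W = measure lebesgue (\<Union>j\<le>J. t j)" by simp
  also have "\<dots> \<le> measure lebesgue Q"
  proof (rule measure_mono_fmeasurable)
    have "real j *\<^sub>R e + x \<in> Q" if "j \<le> J" "x \<in> W" for j x
    proof -
      have "\<bar>x $ i - w $ i\<bar> \<le> D" for i
        using component_le_norm_cart[of "x - w" i] D[OF that(2) w] by simp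
      moreover have "0 \<le> real j * e $ i" "real j * e $ i \<le> real J * e $ i" for i
        using that(1) by (auto simp: e_def axis_def)
      ultimately show ?thesis
        unfolding Q_def mem_box_cart by (simp, smt (verit))
    qed
    then show "(\<Union>j\<le>J. t j) \<subseteq> Q"
      by (auto simp: t_def)
  qed (use tm in \<open>auto simp: Q_def intro!: fmeasurableD fmeasurable.finite_UN\<close>)
  also have "\<dots> = 2 * D * (2 * D + real J)"
  proof -
    have "w \<in> Q"
      using \<open>0 \<le> D\<close> unfolding Q_def mem_box_cart by (auto simp: e_def axis_def)
    then have "Q \<noteq> {}" by blast
    then have "measure lebesgue Q = (\<Prod>i\<in>UNIV. 2 * D + real J * e $ i)"
      unfolding Q_def by (subst measure_completion) (simp_all add: content_cbox_cart algebra_simps)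
    also have "\<dots> = 2 * D * (2 * D + real J)"
      using exhaust_2[of k] by (auto simp: UNIV_2 e_def axis_def)
    finally show ?thesis .
  qed
  also have "\<dots> \<le> 2 * D * (2 * (1 + real J))"
    using J \<open>0 \<le> D\<close> by (intro mult_left_mono) auto
  finally have "(1 + real J) * measure lebesgue W \<le> (1 + real J) * (4 * D)"
    by (simp add: algebra_simps)
  then show ?thesis
    by (rule mult_left_le_imp_le) simp
qed

section \<open>Essential loops in the images of an open set\<close>

lemma loop_of_translate_meets:
  assumes "path_connected W" "proj ` W \<subseteq> V" "W \<inter> (+) (of_ivec v) ` W \<noteq> {}"
  obtains \<gamma> where "path \<gamma>" "pathfinish \<gamma> = pathstart \<gamma>" "path_image \<gamma> \<subseteq> V" "has_loop_class \<gamma> v"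
proof -
  obtain y where y: "y \<in> W" "y + of_ivec v \<in> W"
    using assms(3) by (auto simp: add.commute)
  obtain g where g: "path g" "path_image g \<subseteq> W" "pathstart g = y" "pathfinish g = y + of_ivec v"
    using assms(1) y unfolding path_connected_def by blast
  show thesis
  proof (rule that[of "proj \<circ> g"])
    show "path (proj \<circ> g)"
      using g(1) by (intro path_continuous_image continuous_on_proj)
    show "pathfinish (proj \<circ> g) = pathstart (proj \<circ> g)"
      using g(3,4) by (simp add: pathfinish_compose pathstart_compose)
    show "path_image (proj \<circ> g) \<subseteq> V"
      using g(2) assms(2) by (auto simp: path_image_compose)
    show "has_loop_class (proj \<circ> g) v"
      using g by (simp add: has_loop_class_proj_iff)
  qed
qed

text \<open>
  Otherwise, for each of the two coordinate directions, \<open>W\<close> meets its translate by some positive multiple of the basis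
  vector.  The loops obtained from these have linearly independent classes.
\<close>

lemma not_doubly_essential_imp_disjoint_translates:
  assumes "open V" "\<not> doubly_essential V" "path_connected W" "proj ` W \<subseteq> V"
  obtains k where "\<And>j :: nat. j > 0 \<Longrightarrow> W \<inter> (+) (of_nat j *\<^sub>R axis k 1) ` W = {}"
proof (rule ccontr)
  assume "\<not> thesis"
  then have ex: "\<exists>j :: nat. j > 0 \<and> W \<inter> (+) (of_nat j *\<^sub>R axis k 1) ` W \<noteq> {}" for k
    using that by blast
  have loop: "\<exists>j \<gamma>. j \<noteq> 0 \<and> path \<gamma> \<and> pathfinish \<gamma> = pathstart \<gamma> \<and> path_image \<gamma> \<subseteq> V \<and>
      has_loop_class \<gamma> (axis k j)" for k
  proof -
    obtain j :: nat where j: "j > 0" "W \<inter> (+) (of_nat j *\<^sub>R axis k 1) ` W \<noteq> {}"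
      using ex by blast
    have e: "of_nat j *\<^sub>R axis k 1 = of_ivec (axis k (int j))"
      by (simp add: vec_eq_iff axis_def)
    show ?thesis
      using loop_of_translate_meets[OF assms(3,4) j(2)[unfolded e]] \<open>j > 0\<close>
      by (metis of_nat_0_less_iff less_irrefl)
  qed
  obtain j1 \<gamma> where 1: "j1 \<noteq> 0" "path \<gamma>" "pathfinish \<gamma> = pathstart \<gamma>" "path_image \<gamma> \<subseteq> V"
      "has_loop_class \<gamma> (axis 1 j1)"
    using loop by blast
  obtain j2 \<sigma> where 2: "j2 \<noteq> 0" "path \<sigma>" "pathfinish \<sigma> = pathstart \<sigma>" "path_image \<sigma> \<subseteq> V"
      "has_loop_class \<sigma> (axis 2 j2)"
    using loop by blast
  have "\<forall>a b :: int. a *s axis 1 j1 + b *s (axis 2 j2 :: int ^ 2) = 0 \<longrightarrow> a = 0 \<and> b = 0"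
    using 1(1) 2(1) by (auto simp: vec_eq_iff axis_def forall_2)
  with 1 2 \<open>open V\<close> have "doubly_essential V"
    unfolding doubly_essential_def by blast
  with assms(2) show False by contradiction
qed

theorem lemma3p1:
  fixes f :: "torus \<Rightarrow> torus" and A :: "int ^ 2 ^ 2" and l1 l2 :: int and U :: "torus set"
  assumes "torus_endomorphism f"
    and "is_linear_part f A"
    and "eigenvalues A = {of_int l1, of_int l2}"
    and "\<bar>l1\<bar> \<ge> \<bar>l2\<bar>" and "\<bar>l2\<bar> > 1"
    and "strongly_volume_expanding (real_of_int l1) f"
    and "open U" and "U \<noteq> {}"
  shows "\<exists>N. \<forall>n\<ge>N. doubly_essential ((f ^^ n) ` U)"
proof -
  have diffeo: "C1_local_diffeo f"
    using assms(1) by (simp add: torus_endomorphism_def)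
  obtain F where F: "continuous_on UNIV F" and lift: "\<And>x. proj (F x) = f (proj x)"
    using continuous_lift_exists[OF C1_local_diffeo_imp_continuous[OF diffeo]] by blast
  note loc_inj = lift_locally_inj[OF diffeo F lift]
  note opn = locally_inj_imp_open_map[OF F loc_inj]

  define M where "M = map_matrix real_of_int A"
  let ?a = "real_of_int l1" and ?b = "real_of_int l2"
  have CH: "M *v (M *v x) = (?a + ?b) *\<^sub>R (M *v x) - (?a * ?b) *\<^sub>R x" for x
    using Cayley_Hamilton_2[OF assms(3) M_def, of x] by simp
  have ab: "2 \<le> \<bar>?a\<bar>" "\<bar>?b\<bar> \<le> \<bar>?a\<bar>"
    using assms(4,5) by linarith+
  have nz: "?a * ?b \<noteq> 0"
    using assms(4,5) by auto
  \<comment> \<open>The displacement of \<open>F\<close> from its linear part is periodic, hence bounded.\<close>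
  have "F (x + of_ivec v) - M *v (x + of_ivec v) = F x - M *v x" for x v
    by (simp add: lift_translate[OF F lift assms(2)] of_ivec_matrix_mult M_def matrix_vector_right_distrib)
  moreover have "continuous_on UNIV (\<lambda>x. F x - M *v x)"
    by (intro continuous_intros F)
  ultimately obtain K where K: "\<And>x. norm (F x - M *v x) \<le> K"
    using periodic_imp_bounded[of "\<lambda>x. F x - M *v x"] by blast

  have "inj ((*v) M)"
  proof (rule linear_injective_0[THEN iffD2, rule_format])
    fix x assume "M *v x = 0"
    then have "(?a * ?b) *\<^sub>R x = 0"
      using CH[of x] by simp
    then show "x = 0" using nz by simp
  qed simp
  then have "inj F"
    by (intro locally_inj_near_linear_imp_inj[OF F loc_inj _ _ K]) auto
  then have inj: "inj (F ^^ n)" for n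
    by (rule inj_fn)

  obtain C \<mu> where \<mu>: "C > 0" "\<mu> > \<bar>?a\<bar>"
    and vol: "\<And>n p. n \<ge> 1 \<Longrightarrow> C * \<mu> ^ n \<le> \<bar>det (torus_deriv (f ^^ n) p)\<bar>"
    using assms(6) unfolding strongly_volume_expanding_def by blast
  have der: "((F ^^ n) has_derivative (\<lambda>h. torus_deriv (f ^^ n) (proj x) *v h)) (at x)" for n x
    by (intro has_derivative_torus_deriv continuous_on_funpow differentiable_funpow F lift_funpow lift
        lift_differentiable[OF diffeo F lift])

  obtain z r where r: "r > 0" "ball z r \<subseteq> proj -` U"
  proof -
    obtain z where "z \<in> proj -` U"
      using \<open>U \<noteq> {}\<close> torus_cases by (metis ex_in_conv vimage_eq)
    then show thesis
      using that \<open>open U\<close> unfolding open_torus_def by (meson openE)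
  qed
  define B where "B = ball z r"
  have near: "norm (x - y) \<le> 2 * r" if "x \<in> B" "y \<in> B" for x y
    using that dist_triangle3[of x y z] by (simp add: B_def dist_norm norm_minus_commute)

  obtain R where R: "0 \<le> R"
    and growth: "\<And>d n. norm (d 0) \<le> 2 * r \<Longrightarrow> (\<And>n. norm (d (Suc n) - M *v d n) \<le> 2 * K) \<Longrightarrow>
        norm (d n) \<le> R * (1 + real n) * \<bar>?a\<bar> ^ n"
  proof (rule perturbed_orbit_growth[where \<delta> = "2 * r", OF matrix_vector_mul_bounded_linear CH ab(1,2)])
    show "0 \<le> 2 * K"
      using order_trans[OF norm_ge_zero K[of 0]] by simp
  qed (rule that, assumption, blast)

  have diam: "norm ((F ^^ n) x - (F ^^ n) y) \<le> R * (1 + real n) * \<bar>?a\<bar> ^ n"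
    if "x \<in> B" "y \<in> B" for n x y
  proof (rule growth[of "\<lambda>n. (F ^^ n) x - (F ^^ n) y"])
    fix n
    let ?x = "(F ^^ n) x" and ?y = "(F ^^ n) y"
    have eq: "(F ^^ Suc n) x - (F ^^ Suc n) y - M *v (?x - ?y) = (F ?x - M *v ?x) - (F ?y - M *v ?y)"
      by (simp add: matrix_vector_mult_diff_distrib)
    show "norm ((F ^^ Suc n) x - (F ^^ Suc n) y - M *v (?x - ?y)) \<le> 2 * K"
      unfolding eq
      using norm_triangle_ineq4[of "F ?x - M *v ?x" "F ?y - M *v ?y"] K[of ?x] K[of ?y] by linarith
  qed (use near that in simp)

  have mB: "measure lebesgue B > 0"
    using r(1) by (simp add: B_def content_ball_pos)
  then have "\<forall>\<^sub>F n in sequentially. 4 * R * (1 + real n) * \<bar>?a\<bar> ^ n < C * measure lebesgue B * \<mu> ^ n"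
    using \<mu> by (intro linear_times_exponential_eventually_less) auto
  then obtain N where N: "\<And>n. n \<ge> N \<Longrightarrow> 4 * R * (1 + real n) * \<bar>?a\<bar> ^ n < C * measure lebesgue B * \<mu> ^ n"
    unfolding eventually_sequentially by blast

  \<comment> \<open>The lower bound on the Jacobian starts at \<open>n = 1\<close>.\<close>
  show ?thesis
  proof (intro exI[of _ "max 1 N"] allI impI, rule ccontr)
    fix n assume n: "max 1 N \<le> n" and not: "\<not> doubly_essential ((f ^^ n) ` U)"
    define W where "W = (F ^^ n) ` B"
    have "open ((f ^^ n) ` U)"
      using \<open>open U\<close> by (intro open_funpow_image open_map_of_lift[OF lift opn])
    moreover have "path_connected W"
      unfolding W_def B_def
      by (intro path_connected_continuous_image continuous_on_subset[OF continuous_on_funpow[OF F]]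
          convex_imp_path_connected) auto
    moreover have "proj ` W \<subseteq> (f ^^ n) ` U"
      using r(2) by (auto simp: W_def B_def lift_funpow[of F f, OF lift])
    ultimately obtain k where "\<And>j :: nat. j > 0 \<Longrightarrow> W \<inter> (+) (of_nat j *\<^sub>R axis k 1) ` W = {}"
      using not_doubly_essential_imp_disjoint_translates[OF _ not] by blast
    moreover have dW: "norm (x - y) \<le> R * (1 + real n) * \<bar>?a\<bar> ^ n" if "x \<in> W" "y \<in> W" for x y
      using that diam by (auto simp: W_def)
    moreover have "z \<in> B" using r(1) by (simp add: B_def)
    moreover have mW: "W \<in> lmeasurable"
    proof (rule lmeasurable_open)
      show "open W"
        unfolding W_def B_def by (intro open_funpow_image opn) auto
      have "W \<subseteq> cball ((F ^^ n) z) (R * (1 + real n) * \<bar>?a\<bar> ^ n)"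
        using dW \<open>z \<in> B\<close> by (auto simp: W_def dist_norm)
      then show "bounded W"
        using bounded_cball bounded_subset by blast
    qed
    ultimately have "measure lebesgue W \<le> 4 * (R * (1 + real n) * \<bar>?a\<bar> ^ n)"
      by (intro measure_le_of_disjoint_translates[of W _ k]) (auto simp: W_def)
    also have "\<dots> < C * measure lebesgue B * \<mu> ^ n"
      using N[of n] n by simp
    also have "\<dots> = C * \<mu> ^ n * measure lebesgue B" by simp
    also have "\<dots> \<le> measure lebesgue W"
      unfolding W_def
      using der vol[of n] n mW
      by (intro measure_injective_image_ge[where G' = "\<lambda>x h. torus_deriv (f ^^ n) (proj x) *v h"])
         (auto simp: W_def B_def intro: inj_on_subset[OF inj])
    finally show False by simp
  qed
qed

end
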